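(* Let $G$ be a near-triangulation that does not contain the complete graph $K_4$ as an induced subgraph. Then $G$ is $3$-colourable if and only if $G$ is word-representable.
   Context: A graph $G=(V,E)$ is word-representable if there exists a word $w$ over the alphabet $V$ such that for all distinct $x,y\in V$, the letters $x$ and $y$ alternate in $w$ if and only if $(x,y)\in E$. A near-triangulation is a (finite) planar graph, given with a plane embedding, in which every bounded (inner) face is a triangle; the outer face need not be a triangle. A graph is $3$-colourable if its vertices can be coloured with at most $3$ colours so that adjacent vertices receive different colours. *)

theory Defs
  imports "HOL-Analysis.Analysis"
begin

definition simple_graph :: "'v set \<Rightarrow> ('v \<Rightarrow> 'v \<Rightarrow> bool) \<Rightarrow> bool" where
  "simple_graph V E \<longleftrightarrow> finite V \<and>
     (\<forall>x y. E x y \<longrightarrow> x \<in> V \<and> y \<in> V) \<and>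
     (\<forall>x y. E x y \<longrightarrow> E y x) \<and> (\<forall>x. \<not> E x x)"

definition alternate :: "'v list \<Rightarrow> 'v \<Rightarrow> 'v \<Rightarrow> bool" where
  "alternate w x y \<longleftrightarrow>
     (let u = filter (\<lambda>c. c = x \<or> c = y) w in
        \<forall>i. Suc i < length u \<longrightarrow> u ! i \<noteq> u ! Suc i)"

definition word_representable :: "'v set \<Rightarrow> ('v \<Rightarrow> 'v \<Rightarrow> bool) \<Rightarrow> bool" where
  "word_representable V E \<longleftrightarrow>
     (\<exists>w :: 'v list. set w = V \<and>
        (\<forall>x\<in>V. \<forall>y\<in>V. x \<noteq> y \<longrightarrow> (alternate w x y \<longleftrightarrow> E x y)))"

definition three_colourable :: "'v set \<Rightarrow> ('v \<Rightarrow> 'v \<Rightarrow> bool) \<Rightarrow> bool" where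
  "three_colourable V E \<longleftrightarrow>
     (\<exists>c :: 'v \<Rightarrow> nat. (\<forall>v\<in>V. c v < 3) \<and>
        (\<forall>x\<in>V. \<forall>y\<in>V. E x y \<longrightarrow> c x \<noteq> c y))"

definition has_induced_K4 :: "'v set \<Rightarrow> ('v \<Rightarrow> 'v \<Rightarrow> bool) \<Rightarrow> bool" where
  "has_induced_K4 V E \<longleftrightarrow>
     (\<exists>a\<in>V. \<exists>b\<in>V. \<exists>c\<in>V. \<exists>d\<in>V. distinct [a, b, c, d] \<and>
        E a b \<and> E a c \<and> E a d \<and> E b c \<and> E b d \<and> E c d)"

definition plane_embedding ::
  "'v set \<Rightarrow> ('v \<Rightarrow> 'v \<Rightarrow> bool) \<Rightarrow> ('v \<Rightarrow> complex) \<Rightarrow> ('v \<Rightarrow> 'v \<Rightarrow> real \<Rightarrow> complex) \<Rightarrow> bool" where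
  "plane_embedding V E p \<gamma> \<longleftrightarrow>
     inj_on p V \<and>
     (\<forall>x y. E x y \<longrightarrow> arc (\<gamma> x y) \<and> pathstart (\<gamma> x y) = p x \<and> pathfinish (\<gamma> x y) = p y
                     \<and> \<gamma> y x = reversepath (\<gamma> x y)) \<and>
     (\<forall>x y u v. E x y \<and> E u v \<and> {x, y} \<noteq> {u, v} \<longrightarrow>
        path_image (\<gamma> x y) \<inter> path_image (\<gamma> u v) \<subseteq> p ` ({x, y} \<inter> {u, v})) \<and>
     (\<forall>x y z. E x y \<and> z \<in> V \<and> z \<noteq> x \<and> z \<noteq> y \<longrightarrow> p z \<notin> path_image (\<gamma> x y))"

definition drawing ::
  "'v set \<Rightarrow> ('v \<Rightarrow> 'v \<Rightarrow> bool) \<Rightarrow> ('v \<Rightarrow> complex) \<Rightarrow> ('v \<Rightarrow> 'v \<Rightarrow> real \<Rightarrow> complex) \<Rightarrow> complex set" where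
  "drawing V E p \<gamma> = p ` V \<union> \<Union> {path_image (\<gamma> x y) | x y. E x y}"

definition faces ::
  "'v set \<Rightarrow> ('v \<Rightarrow> 'v \<Rightarrow> bool) \<Rightarrow> ('v \<Rightarrow> complex) \<Rightarrow> ('v \<Rightarrow> 'v \<Rightarrow> real \<Rightarrow> complex) \<Rightarrow> complex set set" where
  "faces V E p \<gamma> =
     {connected_component_set (- drawing V E p \<gamma>) z | z. z \<notin> drawing V E p \<gamma>}"

definition triangular_face ::
  "'v set \<Rightarrow> ('v \<Rightarrow> 'v \<Rightarrow> bool) \<Rightarrow> ('v \<Rightarrow> 'v \<Rightarrow> real \<Rightarrow> complex) \<Rightarrow> complex set \<Rightarrow> bool" where
  "triangular_face V E \<gamma> F \<longleftrightarrow>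
     (\<exists>a\<in>V. \<exists>b\<in>V. \<exists>c\<in>V. distinct [a, b, c] \<and> E a b \<and> E b c \<and> E c a \<and>
        frontier F = path_image (\<gamma> a b) \<union> path_image (\<gamma> b c) \<union> path_image (\<gamma> c a))"

definition near_triangulation :: "'v set \<Rightarrow> ('v \<Rightarrow> 'v \<Rightarrow> bool) \<Rightarrow> bool" where
  "near_triangulation V E \<longleftrightarrow> simple_graph V E \<and>
     (\<exists>p \<gamma>. plane_embedding V E p \<gamma> \<and>
        (\<forall>F \<in> faces V E p \<gamma>. bounded F \<longrightarrow> triangular_face V E \<gamma> F))"

end

theory Submission
  imports Defs
begin

text \<open>
  Every 3-colourable graph is word-representable, by an explicit word.

  Conversely, let a word represent \<open>G\<close>. If \<open>v\<close>, \<open>x\<close>, \<open>y\<close> are pairwise adjacent, they occur in the word in a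
  fixed cyclic order, and \<open>x \<rightarrow> y\<close> for the cyclic order \<open>vxy\<close> is a transitive orientation of the
  neighbourhood of \<open>v\<close>. Since \<open>G\<close> has no \<open>K\<^sub>4\<close>, this neighbourhood is triangle-free, so each of its
  vertices is a source or a sink, which gives a 2-colouring \<open>b v\<close> of it with values in \<open>\<int>/2\<close>.

  In a near-triangulation a cochain on oriented edges that vanishes on triangles is a coboundary: a
  cycle with nonzero sum and minimal interior could be shrunk across the triangular face that lies
  inside it along one of its edges. Now \<open>b x y + b y x + 1\<close> is such a cochain over \<open>\<int>/2\<close>, so after
  adding a potential to \<open>b\<close> we may assume \<open>b x y \<noteq> b y x\<close> on all edges. Then the cochain over \<open>\<int>/3\<close>
  with value \<open>1\<close> or \<open>-1\<close> on \<open>(x, y)\<close> according to \<open>b x y\<close> vanishes on triangles as well, and its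
  potential is a proper 3-colouring.
\<close>

section \<open>Words for 3-coloured graphs\<close>

lemma alternate_iff_distinct_adj:
  "alternate w x y \<longleftrightarrow> distinct_adj (filter (\<lambda>c. c = x \<or> c = y) w)"
  by (simp add: alternate_def Let_def distinct_adj_conv_nth)

lemma alternate_commute: "alternate w x y \<longleftrightarrow> alternate w y x"
  by (simp add: alternate_def disj_commute)

lemma alternate_factor: "alternate (as @ u @ bs) x y \<Longrightarrow> alternate u x y"
  by (auto simp: alternate_iff_distinct_adj distinct_adj_append_iff)

lemma alternate_concat:
  assumes "\<And>u. u \<in> set us \<Longrightarrow> filter (\<lambda>c. c = x \<or> c = y) u = [x, y, x, y]" and "x \<noteq> y"
  shows "alternate (concat us) x y"
proof -
  \<comment> \<open>Each block ends in \<open>y\<close>, so the induction has to know that what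
    follows begins with \<open>x\<close>; hence the second conjunct.\<close>
  have "distinct_adj (filter (\<lambda>c. c = x \<or> c = y) (concat us)) \<and>
        (us \<noteq> [] \<longrightarrow> hd (filter (\<lambda>c. c = x \<or> c = y) (concat us)) = x)"
    using assms by (induction us) (auto simp: distinct_adj_Cons)
  then show ?thesis by (simp add: alternate_iff_distinct_adj)
qed

text \<open>The predicate has the shape to which nested filters simplify: \<open>P\<close> stems
  from a filter in a colour word, the disjunction from restricting to a pair of letters.\<close>

lemma filter_pair_none:
  "x \<notin> set xs \<Longrightarrow> y \<notin> set xs \<Longrightarrow> filter (\<lambda>z. P z \<and> (z = x \<or> z = y)) xs = []"
  by (auto simp: filter_empty_conv)

lemma filter_pair_one:
  assumes "distinct xs" "x \<in> set xs" "y \<notin> set xs"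
  shows "filter (\<lambda>z. P z \<and> (z = x \<or> z = y)) xs = (if P x then [x] else [])"
    and "filter (\<lambda>z. P z \<and> (z = y \<or> z = x)) xs = (if P x then [x] else [])"
proof -
  obtain us vs where "xs = us @ x # vs" using assms(2) by (meson split_list)
  with assms show "filter (\<lambda>z. P z \<and> (z = x \<or> z = y)) xs = (if P x then [x] else [])"
    and "filter (\<lambda>z. P z \<and> (z = y \<or> z = x)) xs = (if P x then [x] else [])"
    by (simp_all add: filter_pair_none)
qed

lemmas filter_pair = filter_pair_none filter_pair_none[where P = "\<lambda>_. True", simplified]
  filter_pair_one filter_pair_one[where P = "\<lambda>_. True", simplified]

text \<open>
  Let \<open>A\<close>, \<open>B\<close>, \<open>C\<close> list the three colour classes. In each word below every letter occurs twice and
  adjacent letters \<open>x\<close>, \<open>y\<close>, with \<open>x\<close> of smaller colour, leave the subword \<open>xyxy\<close>, so concatenating such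
  words keeps adjacent letters alternating. In the first word only neighbours of \<open>a\<close> stand between the
  two letters \<open>a\<close>, so \<open>a\<close> alternates with nothing else; the second does the same for \<open>b\<close>, and the
  third stops the letters of \<open>C\<close> from alternating with each other.
\<close>

definition colour_word_0 where
  "colour_word_0 E A B C a =
     filter (\<lambda>z. z \<noteq> a) A @ filter (\<lambda>z. \<not> E a z) B @ [a] @ filter (E a) B @ filter (E a) C @ [a] @
     filter (\<lambda>z. \<not> E a z) C @ filter (\<lambda>z. z \<noteq> a) A @ B @ C"

definition colour_word_1 where
  "colour_word_1 E A B C b =
     A @ filter (\<lambda>z. z \<noteq> b) B @ filter (\<lambda>z. \<not> E b z) C @ [b] @ filter (E b) C @ filter (E b) A @ [b] @
     filter (\<lambda>z. \<not> E b z) A @ filter (\<lambda>z. z \<noteq> b) B @ C"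

definition colour_word_2 where
  "colour_word_2 A B C = A @ B @ C @ A @ B @ rev C"

lemma three_colourable_imp_word_representable:
  fixes V :: "'v set"
  assumes G: "simple_graph V E" and col: "three_colourable V E"
  shows "word_representable V E"
proof -
  have fin: "finite V" and sym: "\<And>x y. E x y \<Longrightarrow> E y x" and EV: "\<And>x y. E x y \<Longrightarrow> x \<in> V \<and> y \<in> V"
    and irr: "\<And>x. \<not> E x x"
    using G by (auto simp: simple_graph_def)
  obtain c :: "'v \<Rightarrow> nat" where c3: "\<And>v. v \<in> V \<Longrightarrow> c v < 3"
    and cne: "\<And>x y. E x y \<Longrightarrow> c x \<noteq> c y"
    using col EV unfolding three_colourable_def by blast
  obtain vs where vs: "set vs = V" "distinct vs" using finite_distinct_list[OF fin] by blast
  define A B C where "A = filter (\<lambda>v. c v = 0) vs" and "B = filter (\<lambda>v. c v = 1) vs"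
    and "C = filter (\<lambda>v. c v = 2) vs"
  have sets: "set A = {v\<in>V. c v = 0}" "set B = {v\<in>V. c v = 1}" "set C = {v\<in>V. c v = 2}"
    and dist: "distinct A" "distinct B" "distinct C"
    using vs by (auto simp: A_def B_def C_def)
  have V_cases: "v \<in> set A \<or> v \<in> set B \<or> v \<in> set C" if "v \<in> V" for v
    using c3[OF that] that by (auto simp: sets)
  have setV: "set A \<union> set B \<union> set C = V" using V_cases by (auto simp: sets)
  have disj: "\<And>v. v \<in> set A \<Longrightarrow> v \<notin> set B" "\<And>v. v \<in> set A \<Longrightarrow> v \<notin> set C"
    "\<And>v. v \<in> set B \<Longrightarrow> v \<notin> set A" "\<And>v. v \<in> set B \<Longrightarrow> v \<notin> set C"
    "\<And>v. v \<in> set C \<Longrightarrow> v \<notin> set A" "\<And>v. v \<in> set C \<Longrightarrow> v \<notin> set B"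
    by (auto simp: sets)
  \<comment> \<open>A nonadjacent pair has a member in \<open>A\<close>, or else one in
    \<open>B\<close>, or else lies in \<open>C\<close>. The first two cases use the block of that
    member; one last block serves all pairs within \<open>C\<close>.\<close>
  define us where "us = map (colour_word_0 E A B C) A @ map (colour_word_1 E A B C) B @ [colour_word_2 A B C]"
  define w where "w = concat us"
  have filt: "filter (\<lambda>z. z = x \<or> z = y) u = [x, y, x, y]"
    if xy: "E x y" and lt: "c x < c y" and u: "u \<in> set us" for x y u
  proof -
    have ne: "x \<noteq> y" using lt by auto
    have yx: "E y x" using sym xy by blast
    consider "x \<in> set A" "y \<in> set B" | "x \<in> set A" "y \<in> set C" | "x \<in> set B" "y \<in> set C"
      using V_cases[of x] V_cases[of y] EV[OF xy] lt by (auto simp: sets)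
    then show ?thesis
    proof cases
      case 1
      note 1 [simp] = 1 disj(1,2)[OF 1(1)] disj(3,4)[OF 1(2)]
      show ?thesis using u unfolding us_def
        by (auto simp: colour_word_0_def colour_word_1_def colour_word_2_def filter_pair dist ne xy yx
              simp flip: rev_filter)
    next
      case 2
      note 2 [simp] = 2 disj(1,2)[OF 2(1)] disj(5,6)[OF 2(2)]
      show ?thesis using u unfolding us_def
        by (auto simp: colour_word_0_def colour_word_1_def colour_word_2_def filter_pair dist ne xy yx
              simp flip: rev_filter)
    next
      case 3
      note 3 [simp] = 3 disj(3,4)[OF 3(1)] disj(5,6)[OF 3(2)]
      show ?thesis using u unfolding us_def
        by (auto simp: colour_word_0_def colour_word_1_def colour_word_2_def filter_pair dist ne xy yx
              simp flip: rev_filter)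
    qed
  qed
  have alt_edge: "alternate w x y" if "E x y" for x y
  proof (cases "c x < c y")
    case True
    then show ?thesis unfolding w_def
      by (intro alternate_concat) (auto simp: filt that)
  next
    case False
    then have "c y < c x" using cne[OF that] by simp
    then have "alternate w y x" unfolding w_def
      by (intro alternate_concat) (auto simp: filt sym that)
    then show ?thesis by (simp add: alternate_commute)
  qed
  have w_alt: "alternate u x y" if u: "u \<in> set us" and alt: "alternate w x y" for u x y
  proof -
    obtain us1 us2 where "us = us1 @ u # us2" using u by (meson split_list)
    then have "w = concat us1 @ u @ concat us2" by (simp add: w_def)
    with alt show ?thesis by (metis alternate_factor)
  qed
  have nalt0: "\<not> alternate w a y" if a: "a \<in> set A" and y: "y \<in> V" "y \<noteq> a" "\<not> E a y" for a y
  proof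
    assume "alternate w a y"
    then have *: "alternate (colour_word_0 E A B C a) a y" using a w_alt by (auto simp: us_def)
    then have "alternate (a # filter (E a) B @ filter (E a) C @ [a]) a y"
      using alternate_factor[of "filter (\<lambda>z. z \<noteq> a) A @ filter (\<lambda>z. \<not> E a z) B"
          "a # filter (E a) B @ filter (E a) C @ [a]"] 
      by (simp add: colour_word_0_def)
    moreover have "filter (\<lambda>z. z = a \<or> z = y) (a # filter (E a) B @ filter (E a) C @ [a]) = [a, a]"
      using y irr by (auto simp: filter_empty_conv)
    ultimately show False by (simp add: alternate_iff_distinct_adj del: filter.simps)
  qed
  have nalt1: "\<not> alternate w b y" if b: "b \<in> set B" and y: "y \<in> set B \<union> set C" "y \<noteq> b" "\<not> E b y" for b y
  proof
    assume "alternate w b y"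
    then have *: "alternate (colour_word_1 E A B C b) b y" using b w_alt by (auto simp: us_def)
    then have "alternate (b # filter (E b) C @ filter (E b) A @ [b]) b y"
      using alternate_factor[of "A @ filter (\<lambda>z. z \<noteq> b) B @ filter (\<lambda>z. \<not> E b z) C"
          "b # filter (E b) C @ filter (E b) A @ [b]"] 
      by (simp add: colour_word_1_def)
    moreover have "filter (\<lambda>z. z = b \<or> z = y) (b # filter (E b) C @ filter (E b) A @ [b]) = [b, b]"
      using y irr by (auto simp: filter_empty_conv)
    ultimately show False by (simp add: alternate_iff_distinct_adj del: filter.simps)
  qed
  have nalt2: "\<not> alternate w x y" if xy: "x \<in> set C" "y \<in> set C" "x \<noteq> y" for x y
  proof
    assume "alternate w x y"
    then have *: "alternate (colour_word_2 A B C) x y" using w_alt by (auto simp: us_def)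
    define u where "u = filter (\<lambda>z. z = x \<or> z = y) C"
    have "x \<in> set u" using xy by (simp add: u_def)
    then have "u \<noteq> []" by auto
    have "filter (\<lambda>z. z = x \<or> z = y) (colour_word_2 A B C) = u @ rev u"
      using disj(5,6)[OF xy(1)] disj(5,6)[OF xy(2)] by (simp add: u_def colour_word_2_def
          filter_pair_none[where P = "\<lambda>_. True", simplified] flip: rev_filter)
    with * have "distinct_adj (u @ rev u)" by (simp add: alternate_iff_distinct_adj)
    \<comment> \<open>At the seam of \<open>u @ rev u\<close> the last letter of \<open>u\<close>
      meets itself.\<close>
    with \<open>u \<noteq> []\<close> show False
      by (simp add: distinct_adj_append_iff hd_rev)
  qed
  have "alternate w x y \<longleftrightarrow> E x y" if "x \<in> V" "y \<in> V" "x \<noteq> y" for x y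
  proof
    assume alt: "alternate w x y"
    then have alt': "alternate w y x" by (simp add: alternate_commute)
    show "E x y"
    proof (rule ccontr)
      assume "\<not> E x y"
      then have "\<not> E y x" using sym by blast
      then show False
        using V_cases[OF that(1)] V_cases[OF that(2)] nalt0[of x y] nalt0[of y x] nalt1[of x y]
          nalt1[of y x] nalt2[of x y] alt alt' that \<open>\<not> E x y\<close>
        by blast
    qed
  qed (rule alt_edge)
  moreover have "set w = V"
  proof -
    have "set u \<subseteq> V" if "u \<in> set us" for u
      using that setV by (auto simp: us_def colour_word_0_def colour_word_1_def colour_word_2_def)
    moreover have "V \<subseteq> set w"
      using setV by (auto simp: w_def us_def colour_word_2_def)
    ultimately show ?thesis by (auto simp: w_def)
  qed
  ultimately show ?thesis unfolding word_representable_def by blast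
qed

section \<open>Neighbourhoods in word-representable graphs\<close>

text \<open>The subword on \<open>v\<close>, \<open>x\<close>, \<open>y\<close> is a factor of \<open>vxyvxyvxy\<dots>\<close>.\<close>

definition cyclic_in :: "'v list \<Rightarrow> 'v \<Rightarrow> 'v \<Rightarrow> 'v \<Rightarrow> bool" where
  "cyclic_in w v x y \<longleftrightarrow>
     successively (\<lambda>p q. (p, q) \<in> {(v, x), (x, y), (y, v)}) (filter (\<lambda>z. z \<in> {v, x, y}) w)"

text \<open>Reads the cyclic pattern off the unfiltered word, so that the patterns of two different
  triples can be compared at the same positions.\<close>

lemma cyclic_in_step:
  assumes "cyclic_in w v x y" "w = as @ p # bs @ q # cs"
    "p \<in> {v, x, y}" "q \<in> {v, x, y}" "set bs \<inter> {v, x, y} = {}"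
  shows "(p, q) \<in> {(v, x), (x, y), (y, v)}"
proof -
  have "filter (\<lambda>z. z \<in> {v, x, y}) bs = []" using assms(5) by (auto simp: filter_empty_conv)
  then have "filter (\<lambda>z. z \<in> {v, x, y}) w =
      filter (\<lambda>z. z \<in> {v, x, y}) as @ [p, q] @ filter (\<lambda>z. z \<in> {v, x, y}) cs"
    using assms(2-4) by (simp del: insert_iff)
  then show ?thesis using assms(1)
    by (simp add: cyclic_in_def successively_append_iff del: insert_iff)
qed

lemma successively_iff_nth:
  "successively P xs \<longleftrightarrow> (\<forall>i. Suc i < length xs \<longrightarrow> P (xs ! i) (xs ! Suc i))"
  by (induction P xs rule: successively.induct) (auto simp: nth_Cons split: nat.splits)

lemma alternate_filter:
  assumes "P x" "P y"
  shows "alternate (filter P w) x y \<longleftrightarrow> alternate w x y"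
proof -
  have "(\<lambda>z. P z \<and> (z = x \<or> z = y)) = (\<lambda>z. z = x \<or> z = y)" using assms by auto
  then show ?thesis by (simp add: alternate_iff_distinct_adj)
qed

text \<open>In the subword on the three letters, any three consecutive letters are distinct. Hence
  two consecutive letters determine the next one, and the subword has period three in one of the two
  cyclic orders.\<close>

lemma cyclic_in_total:
  assumes dist: "distinct [v, x, y]"
    and alt: "alternate w v x" "alternate w v y" "alternate w x y"
  shows "cyclic_in w v x y \<or> cyclic_in w v y x"
proof -
  define u where "u = filter (\<lambda>z. z \<in> {v, x, y}) w"
  have alt_u: "alternate u v x" "alternate u v y" "alternate u x y"
    using alt by (simp_all add: u_def alternate_filter)
  have u_in: "u ! i \<in> {v, x, y}" if "i < length u" for i
    using nth_mem[OF that] by (simp add: u_def)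
  have ne: "u ! i \<noteq> u ! Suc i" if i: "Suc i < length u" for i
  proof -
    have eq: "u = take i u @ [u ! i, u ! Suc i] @ drop (Suc (Suc i)) u"
      using i by (metis Cons_nth_drop_Suc Suc_lessD append_Cons append_Nil append_take_drop_id)
    note f = alternate_factor[of "take i u" "[u ! i, u ! Suc i]" "drop (Suc (Suc i)) u", folded eq]
    show ?thesis
      using f[OF alt_u(1)] f[OF alt_u(2)] f[OF alt_u(3)] u_in[of i] i
      by (auto simp: alternate_iff_distinct_adj)
  qed
  have ne2: "u ! i \<noteq> u ! Suc (Suc i)" if i: "Suc (Suc i) < length u" for i
  proof -
    have eq: "u = take i u @ [u ! i, u ! Suc i, u ! Suc (Suc i)] @ drop (Suc (Suc (Suc i))) u"
      using i by (metis Cons_nth_drop_Suc Suc_lessD append_Cons append_Nil append_take_drop_id)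
    note f = alternate_factor[of "take i u" "[u ! i, u ! Suc i, u ! Suc (Suc i)]"
        "drop (Suc (Suc (Suc i))) u", folded eq]
    show ?thesis
    proof
      assume eq2: "u ! i = u ! Suc (Suc i)"
      \<comment> \<open>\<open>s\<close> is the letter of the triple missing at these three places.
        Restricting to \<open>u ! i\<close> and \<open>s\<close> brings the two equal letters
        together.\<close>
      obtain s where s: "s \<in> {v, x, y}" "s \<noteq> u ! i" "s \<noteq> u ! Suc i"
        using dist by (metis distinct_length_2_or_more insertCI)
      have "u ! i \<in> {v, x, y}" using u_in i by simp
      then have "alternate u (u ! i) s"
        using s alt_u alternate_commute[of u] by (elim insertE emptyE) simp_all
      from f[OF this] show False
        using s ne[of i] i by (simp add: alternate_iff_distinct_adj eq2[symmetric])
    qed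
  qed
  \<comment> \<open>The first two letters decide the rest; \<open>s\<close> and \<open>t\<close>
    stand for \<open>x\<close> and \<open>y\<close> in either order, which covers both
    orientations.\<close>
  have run: "(u ! i, u ! Suc i) \<in> {(v, s), (s, t), (t, v)}"
    if start: "(u ! 0, u ! 1) \<in> {(v, s), (s, t), (t, v)}" and i: "Suc i < length u"
      and st: "{s, t} = {x, y}" for i s t
    using i
  proof (induction i)
    case 0
    then show ?case using start by simp
  next
    case (Suc i)
    then have "(u ! i, u ! Suc i) \<in> {(v, s), (s, t), (t, v)}" by simp
    moreover have "u ! Suc (Suc i) \<in> {v, s, t}" using u_in[OF Suc.prems] st by auto
    ultimately show ?case
      using ne[of "Suc i"] ne2[of i] Suc.prems by auto
  qed
  have "{v, y, x} = {v, x, y}" by auto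
  then have u': "u = filter (\<lambda>z. z \<in> {v, y, x}) w" by (simp only: u_def)
  show ?thesis
  proof (cases "1 < length u")
    case True
    then have "u ! 0 \<in> {v, x, y}" "u ! 1 \<in> {v, x, y}" "u ! 0 \<noteq> u ! 1"
      using u_in[of 0] u_in[of 1] ne[of 0] by (simp_all del: insert_iff length_greater_0_conv)
    then have "(u ! 0, u ! 1) \<in> {(v, x), (x, y), (y, v)} \<or> (u ! 0, u ! 1) \<in> {(v, y), (y, x), (x, v)}"
      by auto
    then show ?thesis
    proof
      assume "(u ! 0, u ! 1) \<in> {(v, x), (x, y), (y, v)}"
      then have "cyclic_in w v x y"
        unfolding cyclic_in_def u_def[symmetric] successively_iff_nth using run[of x y] by blast
      then show ?thesis ..
    next
      assume "(u ! 0, u ! 1) \<in> {(v, y), (y, x), (x, v)}"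
      then have "cyclic_in w v y x"
        unfolding cyclic_in_def u'[symmetric] successively_iff_nth using run[of y x] by blast
      then show ?thesis ..
    qed
  next
    case False
    \<comment> \<open>With fewer than two letters the pattern holds vacuously.\<close>
    then have "cyclic_in w v x y"
      unfolding cyclic_in_def u_def[symmetric] successively_iff_nth by simp
    then show ?thesis ..
  qed
qed

text \<open>The first two letters of the subword already tell the orientations apart; the
  occurrences of \<open>x\<close> and \<open>y\<close> guarantee that there are two.\<close>

lemma cyclic_in_asym:
  assumes "distinct [v, x, y]" "x \<in> set w" "y \<in> set w" "cyclic_in w v x y"
  shows "\<not> cyclic_in w v y x"
proof
  assume c': "cyclic_in w v y x"
  define u where "u = filter (\<lambda>z. z \<in> {v, x, y}) w"
  have "{v, y, x} = {v, x, y}" by auto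
  then have u': "u = filter (\<lambda>z. z \<in> {v, y, x}) w" by (simp only: u_def)
  have "x \<in> set u" "y \<in> set u" using assms by (auto simp: u_def)
  then obtain p q r where "u = p # q # r"
    using assms(1) by (cases u; cases "tl u") auto
  then show False
    using assms(1,4) c' unfolding cyclic_in_def u_def[symmetric] u'[symmetric] by auto
qed

section \<open>Transitivity of the cyclic orders\<close>

lemma split_at_consecutive:
  assumes "Suc i < length u"
  shows "u = take i u @ u ! i # u ! Suc i # drop (Suc (Suc i)) u"
  using assms by (metis Cons_nth_drop_Suc Suc_lessD append_take_drop_id)

lemma filter_eq_appendD:
  "filter P w = ps @ qs \<Longrightarrow> \<exists>w1 w2. w = w1 @ w2 \<and> filter P w1 = ps \<and> filter P w2 = qs"
proof (induction ps arbitrary: w)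
  case Nil
  then show ?case by (intro exI[of _ "[]"] exI[of _ w]) simp
next
  case (Cons p ps)
  then obtain us vs where w: "w = us @ p # vs" "\<forall>u\<in>set us. \<not> P u" "P p" "filter P vs = ps @ qs"
    by (auto dest!: filter_eq_ConsD)
  with Cons.IH obtain w1 w2 where "vs = w1 @ w2" "filter P w1 = ps" "filter P w2 = qs" by blast
  with w show ?case by (intro exI[of _ "us @ p # w1"] exI[of _ w2]) simp
qed

text \<open>Two equal neighbours in the restricted word are pulled back to two positions of the word
  itself.\<close>

lemma not_alternate_factor:
  assumes "\<not> alternate w x y"
  obtains as c bs cs where "w = as @ c # bs @ c # cs" "c = x \<or> c = y" "x \<notin> set bs" "y \<notin> set bs"
proof -
  let ?P = "\<lambda>c. c = x \<or> c = y"
  let ?u = "filter ?P w"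
  obtain i where i: "Suc i < length ?u" "?u ! i = ?u ! Suc i"
    using assms by (auto simp: alternate_def Let_def)
  have "?u = take i ?u @ ?u ! i # ?u ! i # drop (Suc (Suc i)) ?u"
    by (rule split_at_consecutive[OF i(1), folded i(2)])
  then obtain c ps qs where u: "?u = ps @ c # c # qs" by blast
  from filter_eq_appendD[OF u] obtain w1 w2 where w: "w = w1 @ w2" and w2: "filter ?P w2 = c # c # qs"
    by blast
  from filter_eq_ConsD[OF w2] obtain l w3
    where l: "w2 = l @ c # w3" "?P c" and w3: "c # qs = filter ?P w3" by blast
  from filter_eq_ConsD[OF w3[symmetric]] obtain bs w4
    where "w3 = bs @ c # w4" "\<forall>z\<in>set bs. \<not> ?P z" by blast
  then show thesis using that[of "w1 @ l" c bs w4] w l by auto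
qed

text \<open>Consider two letters \<open>x\<close> with neither \<open>x\<close> nor \<open>z\<close>
  between them. The order \<open>vxy\<close> puts a \<open>y\<close> and then a \<open>v\<close>
  between them, but the order \<open>vyz\<close> demands a \<open>z\<close> after that
  \<open>y\<close> and before that \<open>v\<close>. For two letters \<open>z\<close>,
  symmetrically, a \<open>v\<close> and then a \<open>y\<close> occur with no \<open>x\<close>
  between, against the order \<open>vxy\<close>.\<close>

lemma cyclic_in_trans:
  assumes dist: "distinct [v, x, y, z]" and xy: "cyclic_in w v x y" and yz: "cyclic_in w v y z"
  shows "alternate w x z"
proof (rule ccontr)
  assume "\<not> alternate w x z"
  then obtain as c bs cs where w: "w = as @ c # bs @ c # cs" and c: "c = x \<or> c = z"
    and bs: "x \<notin> set bs" "z \<notin> set bs" by (rule not_alternate_factor)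
  from c show False
  proof
    assume c: "c = x"
    \<comment> \<open>Appending the closing \<open>x\<close> ensures that the search for the next
      letter of the triple succeeds.\<close>
    obtain l m r where 1: "bs @ [x] = l @ m # r" "m \<in> {v, x, y}" "\<forall>t\<in>set l. t \<notin> {v, x, y}"
      using split_list_first_prop[of "bs @ [x]" "\<lambda>t. t \<in> {v, x, y}"] by auto
    have w1: "w = as @ x # l @ m # (r @ cs)" using w c arg_cong[OF 1(1), of "\<lambda>t. t @ cs"] by simp
    have m: "m = y" using cyclic_in_step[OF xy w1] 1 dist by auto
    then have "r \<noteq> []" using 1(1) dist by auto
    then have "last r = x" using arg_cong[OF 1(1), of last] by simp
    then have "x \<in> set r" using \<open>r \<noteq> []\<close> by auto
    then obtain l' m' r' where 2: "r = l' @ m' # r'" "m' \<in> {v, x, y}" "\<forall>t\<in>set l'. t \<notin> {v, x, y}"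
      using split_list_first_prop[of r "\<lambda>t. t \<in> {v, x, y}"] by auto
    have w2: "w = (as @ x # l) @ y # l' @ m' # (r' @ cs)" using w1 2 m by simp
    have m': "m' = v" using cyclic_in_step[OF xy w2] 2 dist by auto
    have "z \<notin> set l'" using bs arg_cong[OF 1(1), of set] dist 2(1) by auto
    then show False using cyclic_in_step[OF yz w2] 2 m' dist by auto
  next
    assume c: "c = z"
    obtain l m r where 1: "bs @ [z] = l @ m # r" "m \<in> {v, y, z}" "\<forall>t\<in>set l. t \<notin> {v, y, z}"
      using split_list_first_prop[of "bs @ [z]" "\<lambda>t. t \<in> {v, y, z}"] by auto
    have w1: "w = as @ z # l @ m # (r @ cs)" using w c arg_cong[OF 1(1), of "\<lambda>t. t @ cs"] by simp
    have m: "m = v" using cyclic_in_step[OF yz w1] 1 dist by auto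
    then have "r \<noteq> []" using 1(1) dist by auto
    then have "last r = z" using arg_cong[OF 1(1), of last] by simp
    then have "z \<in> set r" using \<open>r \<noteq> []\<close> by auto
    then obtain l' m' r' where 2: "r = l' @ m' # r'" "m' \<in> {v, y, z}" "\<forall>t\<in>set l'. t \<notin> {v, y, z}"
      using split_list_first_prop[of r "\<lambda>t. t \<in> {v, y, z}"] by auto
    have w2: "w = (as @ z # l) @ v # l' @ m' # (r' @ cs)" using w1 2 m by simp
    have m': "m' = y" using cyclic_in_step[OF yz w2] 2 dist by auto
    have "x \<notin> set l'" using bs arg_cong[OF 1(1), of set] dist 2(1) by auto
    then show False using cyclic_in_step[OF xy w2] 2 m' dist by auto
  qed
qed

text \<open>Extracts from the word all that the plane argument uses: a proper 2-colouring of each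
  neighbourhood.\<close>

lemma word_representable_imp_locally_bipartite:
  assumes G: "simple_graph V E" and "word_representable V E" and K4: "\<not> has_induced_K4 V E"
  shows "\<exists>b :: 'v \<Rightarrow> 'v \<Rightarrow> bool. \<forall>v x y. E v x \<and> E v y \<and> E x y \<longrightarrow> b v x \<noteq> b v y"
proof -
  have sym: "\<And>x y. E x y \<Longrightarrow> E y x" and EV: "\<And>x y. E x y \<Longrightarrow> x \<in> V \<and> y \<in> V" and irr: "\<And>x. \<not> E x x"
    using G by (auto simp: simple_graph_def)
  obtain w where w: "set w = V"
    and rep: "\<And>x y. x \<in> V \<Longrightarrow> y \<in> V \<Longrightarrow> x \<noteq> y \<Longrightarrow> alternate w x y \<longleftrightarrow> E x y"
    using assms(2) unfolding word_representable_def by blast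
  \<comment> \<open>\<open>b v x\<close> marks the vertices with an outgoing edge in the orientation
    of the neighbourhood of \<open>v\<close>. By \<open>no\<close> below, the head of an edge is
    never marked.\<close>
  define b where "b v x \<longleftrightarrow> (\<exists>y. E v y \<and> E x y \<and> cyclic_in w v x y)" for v x
  have alt: "alternate w x y" if "E x y" for x y
    using rep[of x y] EV[OF that] that irr by metis
  have no: "\<not> b v y" if "E v x" "E v y" "E x y" "cyclic_in w v x y" for v x y
  proof
    assume "b v y"
    then obtain z where z: "E v z" "E y z" "cyclic_in w v y z" by (auto simp: b_def)
    have d: "distinct [v, x, y]" "distinct [v, y, z]" using that z irr by auto
    \<comment> \<open>If \<open>x = z\<close>, the edge between \<open>x\<close> and
      \<open>y\<close> would be oriented both ways.\<close>
    have "x \<noteq> z" using cyclic_in_asym[OF d(1) _ _ that(4)] z(3) EV[OF that(3)] w by auto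
    then have "distinct [v, x, y, z]" using d by auto
    then have "alternate w x z" by (rule cyclic_in_trans[OF _ that(4) z(3)])
    then have "E x z" using rep \<open>x \<noteq> z\<close> EV that z by blast
    then show False
      using K4 \<open>distinct [v, x, y, z]\<close> that(1-3) z(1,2) EV unfolding has_induced_K4_def by metis
  qed
  have "b v x \<noteq> b v y" if "E v x" "E v y" "E x y" for v x y
  proof -
    have "distinct [v, x, y]" using that irr by auto
    then have "cyclic_in w v x y \<or> cyclic_in w v y x"
      using that by (intro cyclic_in_total) (auto intro: alt)
    then show ?thesis
    proof
      assume "cyclic_in w v x y"
      moreover from this have "b v x" using that unfolding b_def by blast
      ultimately show ?thesis using no[of v x y] that by blast
    next
      assume "cyclic_in w v y x"
      moreover from this have "b v y" using that sym unfolding b_def by blast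
      ultimately show ?thesis using no[of v y x] that sym by blast
    qed
  qed
  then show ?thesis by blast
qed

section \<open>Closed walks and potentials\<close>

fun walk_edges :: "'v list \<Rightarrow> ('v \<times> 'v) set" where
  "walk_edges (x # y # zs) = insert (x, y) (walk_edges (y # zs))"
| "walk_edges _ = {}"

fun walk_sum :: "('v \<Rightarrow> 'v \<Rightarrow> 'a::ab_group_add) \<Rightarrow> 'v list \<Rightarrow> 'a" where
  "walk_sum g (x # y # zs) = g x y + walk_sum g (y # zs)"
| "walk_sum g _ = 0"

text \<open>The lower bound 3 excludes an edge run back and forth, which encloses no region;
  antisymmetry makes its sum vanish anyway.\<close>

definition graph_cycle :: "('v \<Rightarrow> 'v \<Rightarrow> bool) \<Rightarrow> 'v list \<Rightarrow> bool" where
  "graph_cycle E xs \<longleftrightarrow> distinct xs \<and> 3 \<le> length xs \<and> successively E xs \<and> E (last xs) (hd xs)"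

definition cycle_edges :: "'v list \<Rightarrow> ('v \<times> 'v) set" where
  "cycle_edges xs = insert (last xs, hd xs) (walk_edges xs)"

definition cycle_sum :: "('v \<Rightarrow> 'v \<Rightarrow> 'a::ab_group_add) \<Rightarrow> 'v list \<Rightarrow> 'a" where
  "cycle_sum g xs = walk_sum g xs + g (last xs) (hd xs)"

lemma walk_edges_append:
  "walk_edges (xs @ y # ys) = walk_edges (xs @ [y]) \<union> walk_edges (y # ys)"
  by (induction xs rule: walk_edges.induct) auto

lemma walk_sum_append:
  "walk_sum g (xs @ y # ys) = walk_sum g (xs @ [y]) + walk_sum g (y # ys)"
  by (induction xs rule: walk_edges.induct) (auto simp: algebra_simps)

lemma walk_edges_nth:
  "(u, v) \<in> walk_edges xs \<Longrightarrow> \<exists>i. Suc i < length xs \<and> u = xs ! i \<and> v = xs ! Suc i"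
proof (induction xs rule: walk_edges.induct)
  case (1 x y zs)
  show ?case
  proof (cases "(u, v) = (x, y)")
    case True
    then show ?thesis by (intro exI[of _ 0]) simp
  next
    case False
    with 1 obtain i where "Suc i < length (y # zs) \<and> u = (y # zs) ! i \<and> v = (y # zs) ! Suc i" by auto
    then show ?thesis by (intro exI[of _ "Suc i"]) simp
  qed
qed auto

lemma walk_edges_in_set: "(u, v) \<in> walk_edges xs \<Longrightarrow> u \<in> set xs \<and> v \<in> set xs"
  using walk_edges_nth[of u v xs] by auto

lemma walk_edges_successively: "successively E xs \<Longrightarrow> (u, v) \<in> walk_edges xs \<Longrightarrow> E u v"
  by (induction xs rule: walk_edges.induct) auto

lemma walk_sum_rev:
  assumes "\<And>x y. E x y \<Longrightarrow> g y x = - g x y"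
  shows "successively E xs \<Longrightarrow> walk_sum g (rev xs) = - walk_sum g xs"
proof (induction xs rule: walk_edges.induct)
  case (1 x y zs)
  have "walk_sum g (rev (x # y # zs)) = walk_sum g (rev (y # zs)) + g y x"
    using walk_sum_append[of g "rev zs" y "[x]"] by simp
  with 1 assms show ?case by simp
qed auto

text \<open>Strong induction on the length. A closed walk that repeats a vertex before its end
  splits there into two shorter closed walks; any other one is a cycle, a single vertex, or an edge
  run back and forth.\<close>

lemma closed_walk_sum_eq_0:
  assumes anti: "\<And>x y. E x y \<Longrightarrow> g y x = - g x y" and irr: "\<And>x. \<not> E x x"
    and cyc: "\<And>xs. graph_cycle E xs \<Longrightarrow> cycle_sum g xs = 0"
  shows "successively E xs \<Longrightarrow> xs \<noteq> [] \<Longrightarrow> hd xs = last xs \<Longrightarrow> walk_sum g xs = 0"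
proof (induction "length xs" arbitrary: xs rule: less_induct)
  case less
  obtain ys h where xs: "xs = ys @ [h]" using less.prems(2) by (metis append_butlast_last_id)
  show ?case
  proof (cases "distinct ys")
    case True
    consider "ys = []" | a where "ys = [a]" | a b where "ys = [a, b]" | "3 \<le> length ys"
      by (cases ys; cases "tl ys"; cases "tl (tl ys)") auto
    then show ?thesis
    proof cases
      case 1
      then show ?thesis using xs by simp
    next
      case 2
      then show ?thesis using xs less.prems irr by simp
    next
      case 3
      then show ?thesis using xs less.prems anti[of a b] by simp
    next
      case 4
      then have ne: "ys \<noteq> []" by auto
      then obtain zs l where zs: "ys = zs @ [l]" by (metis append_butlast_last_id)
      have h: "h = hd ys" using less.prems(3) xs ne by simp
      have "graph_cycle E ys"
        using 4 True less.prems(1) ne h by (auto simp: graph_cycle_def xs successively_append_iff)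
      moreover have "walk_sum g xs = cycle_sum g ys"
        using walk_sum_append[of g zs l "[h]"] by (simp add: xs zs cycle_sum_def flip: h[unfolded zs])
      ultimately show ?thesis using cyc by simp
    qed
  next
    case False
    \<comment> \<open>The piece from \<open>z\<close> to \<open>z\<close> is cut out; both it and
      the remainder are closed and shorter.\<close>
    then obtain p z q r where ys: "ys = p @ [z] @ q @ [z] @ r" using not_distinct_decomp by blast
    have xs': "xs = p @ z # (q @ z # (r @ [h]))" using xs ys by simp
    have s: "successively E (p @ z # (q @ z # (r @ [h])))" using less.prems(1) xs' by simp
    have 1: "walk_sum g (z # q @ [z]) = 0"
    proof (rule less.hyps)
      have "successively E ((z # q @ [z]) @ (r @ [h]))"
        using s by (auto simp: successively_append_iff)
      then show "successively E (z # q @ [z])" by (simp only: successively_append_iff)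
    qed (auto simp: xs')
    have 2: "walk_sum g (p @ z # (r @ [h])) = 0"
    proof (rule less.hyps)
      have "successively E (q @ z # (r @ [h]))" "successively E (p @ [z])"
        using s by (auto simp: successively_append_iff successively_Cons)
      then show "successively E (p @ z # (r @ [h]))"
        by (auto simp: successively_append_iff)
      show "hd (p @ z # (r @ [h])) = last (p @ z # (r @ [h]))"
        using less.prems(3) by (cases p) (auto simp: xs')
    qed (auto simp: xs')
    have "walk_sum g xs = walk_sum g (p @ [z]) + (walk_sum g (z # q @ [z]) + walk_sum g (z # r @ [h]))"
      using walk_sum_append[of g p z "q @ z # r @ [h]"] walk_sum_append[of g "z # q" z "r @ [h]"]
      by (simp add: xs')
    then show ?thesis using 1 2 walk_sum_append[of g p z "r @ [h]"] by simp
  qed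
qed

text \<open>The potential of a vertex is the sum along a chosen walk from the root of its component;
  vanishing sums of closed walks make the choice immaterial.\<close>

lemma potential_of_closed_walks:
  assumes sym: "\<And>x y. E x y \<Longrightarrow> E y x" and anti: "\<And>x y. E x y \<Longrightarrow> g y x = - g x y"
    and closed: "\<And>xs. successively E xs \<Longrightarrow> xs \<noteq> [] \<Longrightarrow> hd xs = last xs \<Longrightarrow> walk_sum g xs = 0"
  shows "\<exists>f. \<forall>x y. E x y \<longrightarrow> g x y = f y - f x"
proof -
  define W where "W r v xs \<longleftrightarrow> successively E xs \<and> xs \<noteq> [] \<and> hd xs = r \<and> last xs = v" for r v xs
  \<comment> \<open>The choice depends only on the set of vertices that reach \<open>v\<close>.
    Adjacent vertices have the same such set, hence the same root.\<close>
  define root where "root v = (SOME r. \<exists>xs. W r v xs)" for v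
  define f where "f v = walk_sum g (SOME xs. W (root v) v xs)" for v
  have W_snoc: "W r y (xs @ [y])" if "W r x xs" "E x y" for r x y xs
    using that by (auto simp: W_def successively_append_iff)
  have "\<exists>xs. W v v xs" for v by (intro exI[of _ "[v]"]) (simp add: W_def)
  then have rootW: "\<exists>xs. W (root v) v xs" for v
    unfolding root_def by (rule someI[of "\<lambda>r. \<exists>xs. W r v xs"])
  have W_some: "W (root v) v (SOME xs. W (root v) v xs)" for v by (rule someI_ex[OF rootW])
  have "g x y = f y - f x" if xy: "E x y" for x y
  proof -
    have "(\<exists>xs. W r x xs) \<longleftrightarrow> (\<exists>xs. W r y xs)" for r using W_snoc xy sym by blast
    then have root: "root x = root y" unfolding root_def by simp
    define xs where "xs = (SOME xs. W (root x) x xs)"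
    define ys where "ys = (SOME ys. W (root y) y ys)"
    have xs: "W (root x) x xs" and ys: "W (root y) y ys" unfolding xs_def ys_def by (rule W_some)+
    obtain xs0 where xs0: "xs = xs0 @ [x]" using xs by (metis W_def append_butlast_last_id)
    obtain ys0 where ys0: "ys = ys0 @ [y]" using ys by (metis W_def append_butlast_last_id)
    have "successively E (rev ys)"
      using ys sym by (auto simp: W_def successively_rev elim: successively_mono)
    \<comment> \<open>This closed walk runs from the root to \<open>x\<close>, over the edge to
      \<open>y\<close>, and back to the root.\<close>
    then have "walk_sum g (xs @ rev ys) = 0"
      using xs ys xy root by (intro closed) (auto simp: W_def successively_append_iff hd_rev last_rev)
    moreover have "walk_sum g (xs @ rev ys) = walk_sum g xs + (g x y + walk_sum g (rev ys))"
      using walk_sum_append[of g xs0 x "y # rev ys0"] by (simp add: xs0 ys0)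
    moreover have "walk_sum g (rev ys) = - walk_sum g ys"
      using walk_sum_rev[of E g] anti ys by (auto simp: W_def)
    moreover have "f x = walk_sum g xs" "f y = walk_sum g ys" by (simp_all add: f_def xs_def ys_def)
    ultimately show ?thesis by (simp add: algebra_simps eq_neg_iff_add_eq_0)
  qed
  then show ?thesis by blast
qed

section \<open>Cycles in plane graphs\<close>

text \<open>The outside of \<open>c\<close> is connected, unbounded and disjoint from
  \<open>d\<close>, so it lies outside \<open>d\<close>. Points of \<open>c\<close> are limits of
  the outside of \<open>c\<close>, so the open inside of \<open>d\<close> cannot contain them
  either.\<close>

lemma inside_curve_mono:
  fixes c d :: "real \<Rightarrow> complex"
  assumes c: "simple_path c" "pathfinish c = pathstart c"
    and d: "simple_path d" "pathfinish d = pathstart d"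
    and sub: "path_image d \<subseteq> path_image c \<union> inside (path_image c)"
  shows "inside (path_image d) \<subseteq> inside (path_image c)"
proof
  note C = Jordan_inside_outside[OF c] and D = Jordan_inside_outside[OF d]
  have out: "outside (path_image c) \<subseteq> outside (path_image d)"
  proof
    fix z assume z: "z \<in> outside (path_image c)"
    have disj: "outside (path_image c) \<subseteq> - path_image d" using sub C by blast
    have "outside (path_image c) \<subseteq> connected_component_set (- path_image d) z"
      using z C disj by (intro connected_component_maximal) auto
    then have "\<not> bounded (connected_component_set (- path_image d) z)"
      using C bounded_subset by blast
    then show "z \<in> outside (path_image d)" using z disj by (auto simp: outside_def)
  qed
  fix z assume z: "z \<in> inside (path_image d)"
  have "z \<notin> path_image c"
  proof
    assume "z \<in> path_image c"
    then have "z \<in> closure (outside (path_image c))" using C by (auto simp: frontier_def)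
    then have "inside (path_image d) \<inter> outside (path_image c) \<noteq> {}"
      using z D open_Int_closure_eq_empty[of "inside (path_image d)" "outside (path_image c)"] by blast
    then show False using out D by blast
  qed
  moreover have "z \<notin> outside (path_image c)" using out z D by blast
  ultimately show "z \<in> inside (path_image c)" using C by blast
qed

text \<open>A single edge gets its own clause because joining it to a constant path would not give
  an arc. Lists with fewer than two vertices get a dummy value.\<close>

fun walk_path :: "('v \<Rightarrow> 'v \<Rightarrow> real \<Rightarrow> complex) \<Rightarrow> 'v list \<Rightarrow> real \<Rightarrow> complex" where
  "walk_path \<gamma> [x, y] = \<gamma> x y"
| "walk_path \<gamma> (x # y # z # zs) = \<gamma> x y +++ walk_path \<gamma> (y # z # zs)"
| "walk_path \<gamma> _ = (\<lambda>_. 0)"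

definition edge_points :: "('v \<Rightarrow> 'v \<Rightarrow> real \<Rightarrow> complex) \<Rightarrow> ('v \<times> 'v) set \<Rightarrow> complex set" where
  "edge_points \<gamma> D = (\<Union>(u, v)\<in>D. path_image (\<gamma> u v))"

text \<open>Walk edges join neighbouring positions, and without repetitions a vertex has only one
  position.\<close>

lemma walk_edges_no_chord:
  assumes "distinct xs" "Suc i < j" "j < length xs" "(u, v) \<in> walk_edges xs"
  shows "{u, v} \<noteq> {xs ! i, xs ! j}"
proof -
  obtain k where k: "Suc k < length xs" "u = xs ! k" "v = xs ! Suc k"
    using walk_edges_nth[OF assms(4)] by blast
  have "xs ! k \<noteq> xs ! j \<or> xs ! Suc k \<noteq> xs ! i" "xs ! k \<noteq> xs ! i \<or> xs ! Suc k \<noteq> xs ! j"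
    using assms k by (auto simp: nth_eq_iff_index_eq)
  then show ?thesis by (auto simp: k doubleton_eq_iff)
qed

text \<open>The disjunction rules out the pair of first and last position, which the closing edge
  joins.\<close>

lemma cycle_edges_no_chord:
  assumes "distinct xs" "Suc i < j" "j < length xs" "0 < i \<or> Suc j < length xs" "(u, v) \<in> cycle_edges xs"
  shows "{u, v} \<noteq> {xs ! i, xs ! j}"
proof (cases "(u, v) \<in> walk_edges xs")
  case True
  then show ?thesis using walk_edges_no_chord assms by metis
next
  case False
  have "xs \<noteq> []" using assms(3) by auto
  then have uv: "u = xs ! (length xs - 1)" "v = xs ! 0"
    using False assms(5) by (auto simp: cycle_edges_def last_conv_nth hd_conv_nth)
  have l: "length xs - 1 < length xs" "0 < length xs" "i < length xs" using assms by auto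
  show ?thesis
    unfolding uv doubleton_eq_iff nth_eq_iff_index_eq[OF assms(1) l(1) l(3)]
      nth_eq_iff_index_eq[OF assms(1) l(1) assms(3)] nth_eq_iff_index_eq[OF assms(1) l(2) l(3)]
      nth_eq_iff_index_eq[OF assms(1) l(2) assms(3)]
    using assms(2-4) by linarith
qed

section \<open>Cycles of a plane graph as Jordan curves\<close>

locale plane_graph =
  fixes V :: "'v set" and E :: "'v \<Rightarrow> 'v \<Rightarrow> bool"
    and p :: "'v \<Rightarrow> complex" and \<gamma> :: "'v \<Rightarrow> 'v \<Rightarrow> real \<Rightarrow> complex"
  assumes graph: "simple_graph V E" and embedding: "plane_embedding V E p \<gamma>"
begin

lemma sym: "E x y \<Longrightarrow> E y x"
  and in_V: "E x y \<Longrightarrow> x \<in> V \<and> y \<in> V"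
  and irrefl: "\<not> E x x"
  and finite_V: "finite V"
  using graph by (auto simp: simple_graph_def)

lemma arc_edge: "E x y \<Longrightarrow> arc (\<gamma> x y)"
  and start_edge: "E x y \<Longrightarrow> pathstart (\<gamma> x y) = p x"
  and finish_edge: "E x y \<Longrightarrow> pathfinish (\<gamma> x y) = p y"
  and reverse_edge: "E x y \<Longrightarrow> \<gamma> y x = reversepath (\<gamma> x y)"
  and edges_meet: "E x y \<Longrightarrow> E u v \<Longrightarrow> {x, y} \<noteq> {u, v} \<Longrightarrow>
        path_image (\<gamma> x y) \<inter> path_image (\<gamma> u v) \<subseteq> p ` ({x, y} \<inter> {u, v})"
  and vertex_off_edge: "E x y \<Longrightarrow> z \<in> V \<Longrightarrow> z \<noteq> x \<Longrightarrow> z \<noteq> y \<Longrightarrow> p z \<notin> path_image (\<gamma> x y)"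
  using embedding unfolding plane_embedding_def by blast+

lemma path_image_edge_commute: "E x y \<Longrightarrow> path_image (\<gamma> y x) = path_image (\<gamma> x y)"
  by (simp add: reverse_edge)

lemma path_image_edge_cong:
  "E x y \<Longrightarrow> {u, v} = {x, y} \<Longrightarrow> path_image (\<gamma> u v) = path_image (\<gamma> x y)"
  using path_image_edge_commute by (auto simp: doubleton_eq_iff)

text \<open>By \<open>edges_meet\<close>, different edges share only images of common vertices, so
  this point identifies its edge.\<close>

lemma inner_point_on_edge:
  assumes "E x y"
  shows "\<gamma> x y (1/2) \<in> path_image (\<gamma> x y)" "\<gamma> x y (1/2) \<noteq> p x" "\<gamma> x y (1/2) \<noteq> p y"
proof -
  show "\<gamma> x y (1/2) \<in> path_image (\<gamma> x y)" by (auto simp: path_image_def)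
  have inj: "inj_on (\<gamma> x y) {0..1}" using arc_edge[OF assms] by (simp add: arc_def)
  show "\<gamma> x y (1/2) \<noteq> p x" "\<gamma> x y (1/2) \<noteq> p y"
    using inj_onD[OF inj, of "1/2" 0] inj_onD[OF inj, of "1/2" 1]
      start_edge[OF assms] finish_edge[OF assms] by (auto simp: pathstart_def pathfinish_def)
qed

text \<open>The vertex \<open>x\<close> does not recur, so the first edge meets the rest of the walk
  only at \<open>p y\<close>. Endpoints and image are carried along because \<open>arc_join\<close>
  needs them.\<close>

lemma walk_path_arc:
  assumes "distinct xs" "2 \<le> length xs" "successively E xs"
  shows "arc (walk_path \<gamma> xs) \<and> pathstart (walk_path \<gamma> xs) = p (hd xs) \<and>
    pathfinish (walk_path \<gamma> xs) = p (last xs) \<and>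
    path_image (walk_path \<gamma> xs) = edge_points \<gamma> (walk_edges xs)"
  using assms
proof (induction xs rule: induct_list012)
  case (3 x y zs)
  have xy: "E x y" and s: "successively E (y # zs)" using 3 by simp_all
  show ?case
  proof (cases zs)
    case Nil
    then show ?thesis using xy by (simp add: arc_edge start_edge finish_edge edge_points_def)
  next
    case (Cons z zs')
    let ?ys = "y # zs"
    have IH: "arc (walk_path \<gamma> ?ys)" "pathstart (walk_path \<gamma> ?ys) = p y"
      "pathfinish (walk_path \<gamma> ?ys) = p (last ?ys)"
      "path_image (walk_path \<gamma> ?ys) = edge_points \<gamma> (walk_edges ?ys)"
      using 3 Cons by simp_all
    have "path_image (\<gamma> x y) \<inter> path_image (\<gamma> u v) \<subseteq> {p y}" if uv: "(u, v) \<in> walk_edges ?ys" for u v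
    proof -
      have "x \<notin> {u, v}" using walk_edges_in_set[OF uv] 3(3) by auto
      then show ?thesis using edges_meet[OF xy walk_edges_successively[OF s uv]] by auto
    qed
    then have "path_image (\<gamma> x y) \<inter> path_image (walk_path \<gamma> ?ys) \<subseteq> {pathstart (walk_path \<gamma> ?ys)}"
      unfolding IH edge_points_def by blast
    then have "arc (\<gamma> x y +++ walk_path \<gamma> ?ys)"
      using xy by (intro arc_join) (simp_all add: IH arc_edge finish_edge)
    then show ?thesis using xy IH unfolding Cons
      by (simp add: start_edge finish_edge path_image_join edge_points_def)
  qed
qed simp_all

text \<open>As the cycle has at least three vertices, its closing edge differs from all walk edges
  and meets their arc only at the two ends.\<close>

lemma cycle_curve:
  assumes "graph_cycle E xs"
  obtains c where "simple_path c" "pathfinish c = pathstart c"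
    "path_image c = edge_points \<gamma> (cycle_edges xs)"
proof -
  have xs: "distinct xs" "3 \<le> length xs" "successively E xs" and e: "E (last xs) (hd xs)"
    using assms by (auto simp: graph_cycle_def)
  then have ne: "xs \<noteq> []" by auto
  let ?a = "walk_path \<gamma> xs" and ?b = "\<gamma> (last xs) (hd xs)"
  have a: "arc ?a" "pathstart ?a = p (hd xs)" "pathfinish ?a = p (last xs)"
    "path_image ?a = edge_points \<gamma> (walk_edges xs)"
    using walk_path_arc[of xs] xs by auto
  have "path_image ?b \<inter> path_image (\<gamma> u v) \<subseteq> {p (hd xs), p (last xs)}"
    if uv: "(u, v) \<in> walk_edges xs" for u v
  proof -
    have "{u, v} \<noteq> {xs ! 0, xs ! (length xs - 1)}"
      using walk_edges_no_chord[OF xs(1) _ _ uv] xs(2) by auto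
    then have "{last xs, hd xs} \<noteq> {u, v}" using ne by (auto simp: last_conv_nth hd_conv_nth)
    then show ?thesis using edges_meet[OF e walk_edges_successively[OF xs(3) uv]] by auto
  qed
  then have "path_image ?a \<inter> path_image ?b \<subseteq> {pathstart ?a, pathstart ?b}"
    unfolding a start_edge[OF e] edge_points_def by blast
  then have "simple_path (?a +++ ?b)"
    using e by (intro simple_path_join_loop) (simp_all add: a arc_edge start_edge finish_edge)
  moreover have "pathfinish (?a +++ ?b) = pathstart (?a +++ ?b)" using e by (simp add: a finish_edge)
  moreover have "path_image (?a +++ ?b) = edge_points \<gamma> (cycle_edges xs)"
    using e by (simp add: path_image_join a start_edge edge_points_def cycle_edges_def Un_commute)
  ultimately show thesis by (rule that)
qed

abbreviation "interior_of_cycle xs \<equiv> inside (edge_points \<gamma> (cycle_edges xs))"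

lemma cycle_edges_edge: "graph_cycle E xs \<Longrightarrow> (u, v) \<in> cycle_edges xs \<Longrightarrow> E u v"
  unfolding cycle_edges_def graph_cycle_def using walk_edges_successively by fastforce

text \<open>Strictness comes from an inner point of the new edge \<open>(u, v)\<close>: it lies off
  the old curve, hence inside it, but on the new curve.\<close>

lemma interior_of_cycle_psubset:
  assumes xs: "graph_cycle E xs" and ys: "graph_cycle E ys"
    and sub: "edge_points \<gamma> (cycle_edges ys) \<subseteq> edge_points \<gamma> (cycle_edges xs) \<union> interior_of_cycle xs"
    and uv: "(u, v) \<in> cycle_edges ys" "\<And>x y. (x, y) \<in> cycle_edges xs \<Longrightarrow> {x, y} \<noteq> {u, v}"
  shows "interior_of_cycle ys \<subset> interior_of_cycle xs"
proof -
  obtain c where c: "simple_path c" "pathfinish c = pathstart c"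
    "path_image c = edge_points \<gamma> (cycle_edges xs)" using cycle_curve[OF xs] .
  obtain d where d: "simple_path d" "pathfinish d = pathstart d"
    "path_image d = edge_points \<gamma> (cycle_edges ys)" using cycle_curve[OF ys] .
  have le: "interior_of_cycle ys \<subseteq> interior_of_cycle xs"
    using inside_curve_mono[OF c(1,2) d(1,2)] sub unfolding c d by blast
  have "E u v" using cycle_edges_edge[OF ys uv(1)] .
  define q where "q = \<gamma> u v (1/2)"
  have q: "q \<in> path_image (\<gamma> u v)" "q \<noteq> p u" "q \<noteq> p v"
    using inner_point_on_edge[OF \<open>E u v\<close>] by (auto simp: q_def)
  then have q_ys: "q \<in> edge_points \<gamma> (cycle_edges ys)" using uv(1) by (auto simp: edge_points_def)
  have "q \<notin> path_image (\<gamma> x y)" if "(x, y) \<in> cycle_edges xs" for x y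
    using edges_meet[OF cycle_edges_edge[OF xs that] \<open>E u v\<close> uv(2)[OF that]] q by auto
  then have "q \<notin> edge_points \<gamma> (cycle_edges xs)" by (auto simp: edge_points_def)
  then have "q \<in> interior_of_cycle xs" using q_ys sub by blast
  moreover have "q \<notin> interior_of_cycle ys" using q_ys inside_no_overlap by blast
  ultimately show ?thesis using le by blast
qed

section \<open>Faces next to an edge of a cycle\<close>

text \<open>The predicate \<open>Q\<close> allows for omitting an edge, as is done for
  \<open>rest\<close> in \<open>face_at_cycle_edge\<close>.\<close>

lemma closed_drawing_part:
  assumes "\<And>x y. Q x y \<Longrightarrow> E x y"
  shows "closed (\<Union>{path_image (\<gamma> x y) | x y. Q x y})"
proof -
  have "{path_image (\<gamma> x y) | x y. Q x y} \<subseteq> (\<lambda>(x, y). path_image (\<gamma> x y)) ` (V \<times> V)"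
    using assms in_V by fastforce
  then have "finite {path_image (\<gamma> x y) | x y. Q x y}"
    using finite_V by (meson finite_SigmaI finite_imageI finite_subset)
  then show ?thesis
    using assms by (intro closed_Union) (auto simp: arc_edge closed_arc_image)
qed

lemma closed_drawing: "closed (drawing V E p \<gamma>)"
  unfolding drawing_def using closed_drawing_part[of E] finite_V
  by (simp add: closed_Un finite_imp_closed)

lemma frontier_face_subset: "F \<in> faces V E p \<gamma> \<Longrightarrow> frontier F \<subseteq> drawing V E p \<gamma>"
proof -
  assume "F \<in> faces V E p \<gamma>"
  then have "F \<in> components (- drawing V E p \<gamma>)"
    unfolding faces_def components_def by auto
  then have "frontier F \<subseteq> frontier (- drawing V E p \<gamma>)"
    by (rule frontier_of_components_subset)
  also have "\<dots> \<subseteq> drawing V E p \<gamma>"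
    using closed_drawing by (simp add: frontier_complement frontier_subset_closed)
  finally show ?thesis .
qed

text \<open>A small disc around an inner point \<open>q\<close> of the closing edge meets no other
  part of the drawing. The curve is the frontier of its interior, so the disc contains an interior
  point \<open>z\<close>, and the face of \<open>z\<close> has a frontier point within the
  disc.\<close>

lemma face_at_cycle_edge:
  assumes xs: "graph_cycle E xs"
  obtains F r where "F \<in> faces V E p \<gamma>" "F \<subseteq> interior_of_cycle xs" "r \<in> frontier F"
    "\<And>x y. E x y \<Longrightarrow> r \<in> path_image (\<gamma> x y) \<Longrightarrow> {x, y} = {last xs, hd xs}"
proof -
  define a b where "a = last xs" and "b = hd xs"
  obtain c where c: "simple_path c" "pathfinish c = pathstart c"
    "path_image c = edge_points \<gamma> (cycle_edges xs)" using cycle_curve[OF xs] .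
  note J = Jordan_inside_outside[OF c(1,2), unfolded c(3)]
  have ab: "E a b" using xs by (simp add: a_def b_def graph_cycle_def)
  define q where "q = \<gamma> a b (1/2)"
  have q: "q \<in> path_image (\<gamma> a b)" "q \<noteq> p a" "q \<noteq> p b"
    using inner_point_on_edge[OF ab] by (auto simp: q_def)
  \<comment> \<open>The drawing without the relative interior of the closing edge; comparing
    unordered pairs drops both directions of that edge.\<close>
  define rest where "rest = p ` V \<union> \<Union>{path_image (\<gamma> x y) | x y. E x y \<and> {x, y} \<noteq> {a, b}}"
  have "closed rest" unfolding rest_def
    using closed_drawing_part[of "\<lambda>x y. E x y \<and> {x, y} \<noteq> {a, b}"] finite_V
    by (simp add: closed_Un finite_imp_closed)
  moreover have "q \<notin> rest"
  proof
    assume "q \<in> rest"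
    then consider z where "z \<in> V" "q = p z"
      | x y where "E x y" "{x, y} \<noteq> {a, b}" "q \<in> path_image (\<gamma> x y)"
      unfolding rest_def by auto
    then show False
    proof cases
      case 1
      then show ?thesis using vertex_off_edge[OF ab, of z] q by auto
    next
      case 2
      then show ?thesis using edges_meet[OF 2(1) ab 2(2)] q by auto
    qed
  qed
  ultimately obtain \<epsilon> where \<epsilon>: "\<epsilon> > 0" "ball q \<epsilon> \<subseteq> - rest"
    by (metis ComplI open_Compl open_contains_ball)
  have draw: "drawing V E p \<gamma> \<subseteq> rest \<union> path_image (\<gamma> a b)"
  proof
    fix t assume "t \<in> drawing V E p \<gamma>"
    then consider "t \<in> p ` V" | x y where "E x y" "t \<in> path_image (\<gamma> x y)"
      unfolding drawing_def by blast
    then show "t \<in> rest \<union> path_image (\<gamma> a b)"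
    proof cases
      case 2
      then show ?thesis
        using path_image_edge_cong[OF ab, of x y] unfolding rest_def by (cases "{x, y} = {a, b}") blast+
    qed (simp add: rest_def)
  qed
  have ab_sub: "path_image (\<gamma> a b) \<subseteq> edge_points \<gamma> (cycle_edges xs)"
    by (auto simp: edge_points_def cycle_edges_def a_def b_def)
  have "q \<in> frontier (interior_of_cycle xs)" using q(1) ab_sub J by blast
  then have "q \<in> closure (interior_of_cycle xs)" by (simp add: frontier_def)
  then obtain z where z: "z \<in> interior_of_cycle xs" "dist z q < \<epsilon>"
    using \<epsilon>(1) by (auto simp: closure_approachable)
  have z_ball: "z \<in> ball q \<epsilon>" using z(2) by (simp add: dist_commute)
  have z_draw: "z \<notin> drawing V E p \<gamma>"
    using draw \<epsilon>(2) z_ball ab_sub z(1) inside_no_overlap[of "edge_points \<gamma> (cycle_edges xs)"] by blast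
  define F where "F = connected_component_set (- drawing V E p \<gamma>) z"
  have F: "F \<in> faces V E p \<gamma>" unfolding F_def faces_def using z_draw by auto
  have zF: "z \<in> F" using z_draw by (simp add: F_def)
  have F_draw: "F \<subseteq> - drawing V E p \<gamma>" unfolding F_def by (rule connected_component_subset)
  have cyc_draw: "edge_points \<gamma> (cycle_edges xs) \<subseteq> drawing V E p \<gamma>"
    unfolding edge_points_def drawing_def using cycle_edges_edge[OF xs] by blast
  \<comment> \<open>A face is connected and avoids the cycle, so it cannot leave the
    interior.\<close>
  have F_in: "F \<subseteq> interior_of_cycle xs"
  proof -
    have "connected F" by (simp add: F_def)
    moreover have "F \<inter> frontier (interior_of_cycle xs) = {}" using F_draw cyc_draw J by blast
    ultimately show ?thesis using connected_Int_frontier[of F "interior_of_cycle xs"] zF z(1) by blast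
  qed
  have "q \<notin> F" using F_draw cyc_draw ab_sub q(1) by blast
  \<comment> \<open>\<open>r\<close> is a point where the segment leaves \<open>F\<close>; it need
    not be \<open>q\<close>, but it stays in the disc.\<close>
  then have "closed_segment z q \<inter> frontier F \<noteq> {}"
    using zF by (intro connected_Int_frontier) auto
  then obtain r where r: "r \<in> closed_segment z q" "r \<in> frontier F" by blast
  have "closed_segment z q \<subseteq> ball q \<epsilon>"
    using z_ball \<epsilon>(1) by (intro closed_segment_subset) auto
  then have "r \<notin> rest" using r \<epsilon>(2) by blast
  then have "{x, y} = {a, b}" if "E x y" "r \<in> path_image (\<gamma> x y)" for x y
    using that unfolding rest_def by blast
  then show thesis using that[OF F F_in r(2)] by (simp add: a_def b_def)
qed

text \<open>The face found at the closing edge lies inside the cycle, so it is bounded and has a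
  triangle as frontier. The side through \<open>r\<close> must be the closing edge, and
  \<open>d\<close> is the opposite corner.\<close>

lemma triangle_at_cycle_edge:
  assumes xs: "graph_cycle E xs"
    and near: "\<And>F. F \<in> faces V E p \<gamma> \<Longrightarrow> bounded F \<Longrightarrow> triangular_face V E \<gamma> F"
  obtains d where "E (last xs) d" "E d (hd xs)"
    "path_image (\<gamma> (last xs) d) \<union> path_image (\<gamma> d (hd xs)) \<subseteq>
       edge_points \<gamma> (cycle_edges xs) \<union> interior_of_cycle xs"
proof -
  note found = that
  let ?C = "edge_points \<gamma> (cycle_edges xs)"
  obtain F r where F: "F \<in> faces V E p \<gamma>" "F \<subseteq> interior_of_cycle xs" "r \<in> frontier F"
    and r: "\<And>x y. E x y \<Longrightarrow> r \<in> path_image (\<gamma> x y) \<Longrightarrow> {x, y} = {last xs, hd xs}"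
    using face_at_cycle_edge[OF xs] by metis
  obtain c where c: "simple_path c" "pathfinish c = pathstart c" "path_image c = ?C"
    using cycle_curve[OF xs] .
  note J = Jordan_inside_outside[OF c(1,2), unfolded c(3)]
  have "bounded F" using F(2) J bounded_subset by blast
  then obtain a b d where tri: "E a b" "E b d" "E d a"
    and fr: "frontier F = path_image (\<gamma> a b) \<union> path_image (\<gamma> b d) \<union> path_image (\<gamma> d a)"
    using near[OF F(1)] unfolding triangular_face_def by blast
  have "frontier F \<subseteq> closure (interior_of_cycle xs)"
    using closure_mono[OF F(2)] by (auto simp: frontier_def)
  also have "\<dots> \<subseteq> ?C \<union> interior_of_cycle xs"
    using J closure_Un_frontier[of "interior_of_cycle xs"] by blast
  finally have sub: "frontier F \<subseteq> ?C \<union> interior_of_cycle xs" .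
  \<comment> \<open>Covers a triangle whose side \<open>xy\<close> is the closing edge in either
    direction; the three cases after it rotate the triangle.\<close>
  have result: thesis if t: "E x y" "E y z" "E z x" "{x, y} = {last xs, hd xs}"
      "path_image (\<gamma> y z) \<union> path_image (\<gamma> z x) \<subseteq> frontier F" for x y z
  proof -
    consider "x = last xs" "y = hd xs" | "x = hd xs" "y = last xs"
      using t(4) by (auto simp: doubleton_eq_iff)
    then show thesis
    proof cases
      case 1
      then show ?thesis
        using t sub sym path_image_edge_commute[OF t(2)] path_image_edge_commute[OF t(3)]
        by (intro found[of z]) auto
    next
      case 2
      then show ?thesis using t sub by (intro found[of z]) auto
    qed
  qed
  consider "r \<in> path_image (\<gamma> a b)" | "r \<in> path_image (\<gamma> b d)" | "r \<in> path_image (\<gamma> d a)"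
    using F(3) fr by blast
  then show thesis
  proof cases
    case 1
    then show ?thesis using result[of a b d] r tri fr by blast
  next
    case 2
    then show ?thesis using result[of b d a] r tri fr by blast
  next
    case 3
    then show ?thesis using result[of d a b] r tri fr by blast
  qed
qed

section \<open>Shrinking cycles across triangular faces\<close>

lemma graph_cycle_subset: "graph_cycle E xs \<Longrightarrow> set xs \<subseteq> V"
proof
  fix x assume xs: "graph_cycle E xs" and "x \<in> set xs"
  then obtain us vs where "xs = us @ x # vs" by (meson split_list)
  with xs show "x \<in> V"
    using in_V by (cases vs) (auto simp: graph_cycle_def successively_append_iff)
qed

text \<open>The closing edge is replaced by the detour over \<open>d\<close>, which keeps the sum.
  If \<open>d\<close> already lies on the cycle, the detour splits it into two closed pieces whose
  sums add up to the old one, and a piece with nonzero sum is taken.\<close>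

lemma graph_cycle_shorten:
  assumes xs: "graph_cycle E xs"
    and near: "\<And>F. F \<in> faces V E p \<gamma> \<Longrightarrow> bounded F \<Longrightarrow> triangular_face V E \<gamma> F"
    and anti: "\<And>x y. E x y \<Longrightarrow> g y x = - g x y"
    and tri: "\<And>x y z. E x y \<Longrightarrow> E y z \<Longrightarrow> E z x \<Longrightarrow> g x y + g y z + g z x = 0"
    and nz: "cycle_sum g xs \<noteq> 0"
  shows "\<exists>ys. graph_cycle E ys \<and> cycle_sum g ys \<noteq> 0 \<and> interior_of_cycle ys \<subset> interior_of_cycle xs"
proof -
  define a b where "a = last xs" and "b = hd xs"
  obtain d where ad: "E a d" and db: "E d b"
    and sub: "path_image (\<gamma> a d) \<union> path_image (\<gamma> d b) \<subseteq>
       edge_points \<gamma> (cycle_edges xs) \<union> interior_of_cycle xs"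
    using triangle_at_cycle_edge[OF xs near] unfolding a_def b_def by blast
  have X: "distinct xs" "3 \<le> length xs" "successively E xs" "E a b"
    using xs by (auto simp: graph_cycle_def a_def b_def)
  then have ne: "xs \<noteq> []" by auto
  have gab: "g a b = g a d + g d b"
    using tri[OF ad db sym[OF X(4)]] anti[OF X(4)] by (simp add: algebra_simps)
  have points: "edge_points \<gamma> (cycle_edges ys) \<subseteq> edge_points \<gamma> (cycle_edges xs) \<union> interior_of_cycle xs"
    if "cycle_edges ys \<subseteq> walk_edges xs \<union> {(a, d), (d, b)}" for ys
  proof -
    have "edge_points \<gamma> (cycle_edges ys) \<subseteq> edge_points \<gamma> (walk_edges xs \<union> {(a, d), (d, b)})"
      unfolding edge_points_def by (rule UN_mono[OF that order_refl])
    also have "\<dots> = edge_points \<gamma> (walk_edges xs) \<union> (path_image (\<gamma> a d) \<union> path_image (\<gamma> d b))"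
      by (simp add: edge_points_def Un_ac)
    also have "edge_points \<gamma> (walk_edges xs) \<subseteq> edge_points \<gamma> (cycle_edges xs)"
      by (simp add: edge_points_def cycle_edges_def)
    finally show ?thesis using sub by blast
  qed
  obtain xs0 where xs0: "xs = xs0 @ [a]" using ne by (metis a_def append_butlast_last_id)
  show ?thesis
  proof (cases "d \<in> set xs")
    case False
    let ?ys = "xs @ [d]"
    have ys: "graph_cycle E ?ys"
      using X ad db ne False by (auto simp: graph_cycle_def successively_append_iff a_def b_def)
    have edges: "cycle_edges ?ys = walk_edges xs \<union> {(a, d), (d, b)}"
      using ne walk_edges_append[of xs0 a "[d]"] by (auto simp: cycle_edges_def b_def xs0 hd_append)
    have "cycle_sum g ?ys = cycle_sum g xs"
      using ne walk_sum_append[of g xs0 a "[d]"] gab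
      by (simp add: cycle_sum_def algebra_simps xs0 b_def hd_append)
    moreover have "interior_of_cycle ?ys \<subset> interior_of_cycle xs"
    proof (rule interior_of_cycle_psubset[OF xs ys points])
      show "(d, b) \<in> cycle_edges ?ys" using edges by blast
      show "{x, y} \<noteq> {d, b}" if "(x, y) \<in> cycle_edges xs" for x y
      proof -
        have "x \<in> set xs" "y \<in> set xs"
          using that walk_edges_in_set[of x y xs] ne by (auto simp: cycle_edges_def)
        then show ?thesis using False by (auto simp: doubleton_eq_iff)
      qed
    qed (use edges in blast)
    ultimately show ?thesis using ys nz by metis
  next
    case True
    then obtain us vs where split: "xs = us @ d # vs" by (meson split_list)
    have "d \<noteq> b" "d \<noteq> a" using ad db irrefl by auto
    then have us: "us \<noteq> []" "hd us = b" and vs: "vs \<noteq> []" "last vs = a"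
      using split by (auto simp: a_def b_def hd_append split: if_splits)
    have nth: "xs ! 0 = b" "xs ! length us = d" "xs ! (length xs - 1) = a"
      using ne by (auto simp: split nth_append a_def b_def hd_conv_nth last_conv_nth)
    let ?ys = "us @ [d]" and ?zs = "d # vs"
    have edges: "cycle_edges ?ys \<subseteq> walk_edges xs \<union> {(a, d), (d, b)}"
      "cycle_edges ?zs \<subseteq> walk_edges xs \<union> {(a, d), (d, b)}"
      using us vs walk_edges_append[of us d vs] by (auto simp: cycle_edges_def split)
    have sum: "cycle_sum g xs = cycle_sum g ?ys + cycle_sum g ?zs"
      using us vs walk_sum_append[of g us d vs] gab
      by (simp add: cycle_sum_def split algebra_simps a_def b_def)
    show ?thesis
    proof (cases "cycle_sum g ?ys = 0")
      case False
      \<comment> \<open>With a single vertex in \<open>us\<close> the piece would be the edge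
        between \<open>b\<close> and \<open>d\<close> run back and forth, with sum zero.\<close>
      have len: "2 \<le> length us"
      proof (rule ccontr)
        assume "\<not> 2 \<le> length us"
        with us have "us = [b]" by (cases us; cases "tl us") auto
        then have "cycle_sum g ?ys = g b d + g d b" by (simp add: cycle_sum_def)
        then show False using False anti[OF db] by simp
      qed
      have ys: "graph_cycle E ?ys"
        using X db us len by (auto simp: graph_cycle_def split successively_append_iff)
      have "interior_of_cycle ?ys \<subset> interior_of_cycle xs"
      proof (rule interior_of_cycle_psubset[OF xs ys points[OF edges(1)]])
        show "(d, b) \<in> cycle_edges ?ys" using us by (simp add: cycle_edges_def)
        \<comment> \<open>\<open>b\<close> and \<open>d\<close> stand at positions 0 and
          \<open>length us\<close>, so their edge is a chord and hence new.\<close>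
        show "{x, y} \<noteq> {d, b}" if "(x, y) \<in> cycle_edges xs" for x y
          using cycle_edges_no_chord[OF X(1) _ _ _ that, of 0 "length us"] len vs nth
          by (auto simp: split insert_commute)
      qed
      then show ?thesis using ys False by blast
    next
      case True
      then have nz': "cycle_sum g ?zs \<noteq> 0" using sum nz by simp
      have len: "2 \<le> length vs"
      proof (rule ccontr)
        assume "\<not> 2 \<le> length vs"
        with vs have "vs = [a]" by (cases vs; cases "tl vs") auto
        then have "cycle_sum g ?zs = g d a + g a d" by (simp add: cycle_sum_def)
        then show False using nz' anti[OF ad] by simp
      qed
      have zs: "graph_cycle E ?zs"
        using X ad vs len by (auto simp: graph_cycle_def split successively_append_iff)
      have "interior_of_cycle ?zs \<subset> interior_of_cycle xs"
      proof (rule interior_of_cycle_psubset[OF xs zs points[OF edges(2)]])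
        show "(a, d) \<in> cycle_edges ?zs" using vs by (simp add: cycle_edges_def)
        show "{x, y} \<noteq> {a, d}" if "(x, y) \<in> cycle_edges xs" for x y
          using cycle_edges_no_chord[OF X(1) _ _ _ that, of "length us" "length xs - 1"] len us nth
          by (auto simp: split insert_commute)
      qed
      then show ?thesis using zs nz' by blast
    qed
  qed
qed

text \<open>A finite vertex set has finitely many cycles, so some bad cycle has a minimal interior.
  Minimality refers to interiors rather than lengths because \<open>graph_cycle_shorten\<close> may
  add a vertex.\<close>

lemma triangle_cocycle_potential:
  fixes g :: "'v \<Rightarrow> 'v \<Rightarrow> 'a::ab_group_add"
  assumes near: "\<And>F. F \<in> faces V E p \<gamma> \<Longrightarrow> bounded F \<Longrightarrow> triangular_face V E \<gamma> F"
    and anti: "\<And>x y. E x y \<Longrightarrow> g y x = - g x y"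
    and tri: "\<And>x y z. E x y \<Longrightarrow> E y z \<Longrightarrow> E z x \<Longrightarrow> g x y + g y z + g z x = 0"
  shows "\<exists>f. \<forall>x y. E x y \<longrightarrow> g x y = f y - f x"
proof (rule potential_of_closed_walks[of E g])
  define bad where "bad = {xs. graph_cycle E xs \<and> cycle_sum g xs \<noteq> 0}"
  have "bad \<subseteq> {xs. set xs \<subseteq> V \<and> distinct xs}"
    using graph_cycle_subset by (auto simp: bad_def graph_cycle_def)
  then have fin: "finite bad" using finite_subset_distinct[OF finite_V] finite_subset by blast
  have "bad = {}"
  proof (rule ccontr)
    assume "bad \<noteq> {}"
    then obtain I where I: "I \<in> interior_of_cycle ` bad"
      "\<And>J. J \<in> interior_of_cycle ` bad \<Longrightarrow> J \<subseteq> I \<Longrightarrow> I = J"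
      using finite_has_minimal[of "interior_of_cycle ` bad"] fin by auto
    then obtain xs where xs: "xs \<in> bad" "I = interior_of_cycle xs" by blast
    have "\<exists>ys. graph_cycle E ys \<and> cycle_sum g ys \<noteq> 0 \<and> interior_of_cycle ys \<subset> interior_of_cycle xs"
      by (rule graph_cycle_shorten) (use xs(1) near anti tri in \<open>simp_all add: bad_def\<close>)
    then obtain ys where "ys \<in> bad" "interior_of_cycle ys \<subset> interior_of_cycle xs"
      unfolding bad_def by blast
    then show False using I(2) xs(2) by blast
  qed
  then have cyc: "cycle_sum g xs = 0" if "graph_cycle E xs" for xs using that by (auto simp: bad_def)
  show "walk_sum g xs = 0" if w: "successively E xs" "xs \<noteq> []" "hd xs = last xs" for xs
  proof (rule closed_walk_sum_eq_0[of E g])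
    show "g y x = - g x y" if "E x y" for x y using that by (rule anti)
  qed (simp_all add: irrefl cyc w)
qed (erule sym, erule anti)

section \<open>From 2-coloured neighbourhoods to a 3-colouring\<close>

lemma locally_bipartite_imp_three_colourable:
  fixes b :: "'v \<Rightarrow> 'v \<Rightarrow> bool"
  assumes near: "\<And>F. F \<in> faces V E p \<gamma> \<Longrightarrow> bounded F \<Longrightarrow> triangular_face V E \<gamma> F"
    and b: "\<And>v x y. E v x \<Longrightarrow> E v y \<Longrightarrow> E x y \<Longrightarrow> b v x \<noteq> b v y"
  shows "three_colourable V E"
proof -
  \<comment> \<open>The numeral types \<open>2\<close> and \<open>3\<close> serve as the integers
    modulo 2 and modulo 3.\<close>
  define \<beta> :: "'v \<Rightarrow> 'v \<Rightarrow> 2" where "\<beta> x y = of_bool (b x y)" for x y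
  have two: "z + z = 0" "- z = z" for z :: 2
    using exhaust_2[of z] by auto
  have \<beta>: "\<beta> v x + \<beta> v y = 1" if "E v x" "E v y" "E x y" for v x y
    using b[OF that] by (auto simp: \<beta>_def)
  have "\<exists>f. \<forall>x y. E x y \<longrightarrow> \<beta> x y + \<beta> y x + 1 = f y - f x"
  proof (rule triangle_cocycle_potential)
    fix x y z assume xyz: "E x y" "E y z" "E z x"
    \<comment> \<open>Regrouped by first argument, each corner of the triangle contributes 1, and
      six ones vanish modulo 2.\<close>
    have "(\<beta> x y + \<beta> y x + 1) + (\<beta> y z + \<beta> z y + 1) + (\<beta> z x + \<beta> x z + 1) =
      (\<beta> x y + \<beta> x z) + (\<beta> y x + \<beta> y z) + (\<beta> z x + \<beta> z y) + (1 + 1 + 1)"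
      by (simp only: ac_simps)
    also have "\<dots> = 0" using \<beta>[of x y z] \<beta>[of y x z] \<beta>[of z x y] xyz sym by simp
    finally show "(\<beta> x y + \<beta> y x + 1) + (\<beta> y z + \<beta> z y + 1) + (\<beta> z x + \<beta> x z + 1) = 0" .
  qed (simp_all add: near two add.commute)
  then obtain f where f: "\<And>x y. E x y \<Longrightarrow> \<beta> x y + \<beta> y x + 1 = f y - f x" by blast
  \<comment> \<open>Adding \<open>f x\<close> swaps or keeps the two colours on the whole
    neighbourhood of \<open>x\<close>, so these colourings remain proper, while the equation for
    \<open>f\<close> makes \<open>B x y\<close> and \<open>B y x\<close> differ on edges.\<close>
  define B where "B x y \<longleftrightarrow> \<beta> x y + f x = 1" for x y
  have B_asym: "B x y \<noteq> B y x" if "E x y" for x y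
    using f[OF that] exhaust_2[of "\<beta> x y"] exhaust_2[of "\<beta> y x"] exhaust_2[of "f x"] exhaust_2[of "f y"]
    unfolding B_def by auto
  have B: "B v x \<noteq> B v y" if "E v x" "E v y" "E x y" for v x y
    using \<beta>[OF that] exhaust_2[of "\<beta> v x"] exhaust_2[of "\<beta> v y"] exhaust_2[of "f v"]
    unfolding B_def by auto
  have "\<exists>h. \<forall>x y. E x y \<longrightarrow> (if B x y then 1 else - 1 :: 3) = h y - h x"
  proof (rule triangle_cocycle_potential)
    fix x y z assume xyz: "E x y" "E y z" "E z x"
    \<comment> \<open>Two flips give equality: from \<open>B x y\<close> to \<open>B y x\<close>
      along the edge, then to \<open>B y z\<close> within the neighbourhood of \<open>y\<close>. The
      three equal signs then add up to zero modulo 3.\<close>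
    have "B x y = B y z" "B y z = B z x"
      using B_asym[of x y] B_asym[of y z] B[of y x z] B[of z y x] xyz sym by blast+
    then show "(if B x y then 1 else - 1 :: 3) + (if B y z then 1 else - 1) + (if B z x then 1 else - 1) = 0"
      by simp
  qed (use near B_asym in auto)
  then obtain h :: "'v \<Rightarrow> 3" where h: "\<And>x y. E x y \<Longrightarrow> (if B x y then 1 else - 1) = h y - h x" by blast
  have h_ne: "h x \<noteq> h y" if "E x y" for x y
    using h[OF that] by (auto split: if_splits)
  \<comment> \<open>The remaining residue, 0 modulo 3, gets the colour 2.\<close>
  define c :: "'v \<Rightarrow> nat" where "c v = (if h v = 1 then 0 else if h v = 2 then 1 else 2)" for v
  have "c x \<noteq> c y" if "E x y" for x y
    using h_ne[OF that] exhaust_3[of "h x"] exhaust_3[of "h y"] by (auto simp: c_def split: if_splits)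
  moreover have "c v < 3" for v by (simp add: c_def)
  ultimately show ?thesis unfolding three_colourable_def by blast
qed

end

theorem theorem2:
  fixes V :: "'v set" and E :: "'v \<Rightarrow> 'v \<Rightarrow> bool"
  assumes "near_triangulation V E"
    and "\<not> has_induced_K4 V E"
  shows "three_colourable V E \<longleftrightarrow> word_representable V E"
proof
  have graph: "simple_graph V E" using assms(1) by (simp add: near_triangulation_def)
  show "word_representable V E" if "three_colourable V E"
    using three_colourable_imp_word_representable[OF graph that] .
  assume "word_representable V E"
  then obtain b :: "'v \<Rightarrow> 'v \<Rightarrow> bool" where b: "\<And>v x y. E v x \<Longrightarrow> E v y \<Longrightarrow> E x y \<Longrightarrow> b v x \<noteq> b v y"
    using word_representable_imp_locally_bipartite[OF graph _ assms(2)] by blast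
  obtain p \<gamma> where emb: "plane_embedding V E p \<gamma>"
    and near: "\<And>F. F \<in> faces V E p \<gamma> \<Longrightarrow> bounded F \<Longrightarrow> triangular_face V E \<gamma> F"
    using assms(1) unfolding near_triangulation_def by blast
  interpret plane_graph V E p \<gamma> using graph emb by unfold_locales
  show "three_colourable V E" using locally_bipartite_imp_three_colourable[OF near b] .
qed

end
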